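(* Let $G$ be a connected graph with $\chi(G)=k\ge 3$. Suppose $\mathscr C_0$ is an extendable coloring of $G[S]$ for some $S\subset V(G)$. If there is a pendant vertex $v$ of $G$ with $v\notin S$, then $\mathscr C_0$ is not a Sudoku coloring of $G$.
   Context: Graphs are finite, undirected and simple. A pendant vertex is a vertex of degree $1$. Let $G=(V,E)$ be a connected graph with chromatic number $\chi(G)=k\ge 2$. For $S\subset V$, let $\mathscr C_0$ be a proper coloring of the induced subgraph $G[S]$ with colors from $\{1,\dots,k\}$ (not all colors need be used). An extension of $\mathscr C_0$ is a proper $k$-coloring $V\to\{1,\dots,k\}$ of $G$ whose restriction to $S$ is $\mathscr C_0$. $\mathscr C_0$ is extendable if it has at least one extension, and is a Sudoku coloring of $G$ if it has exactly one extension. *)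

theory Defs
  imports "Graph_Theory.Digraph_Component" "HOL-Library.FuncSet"
begin

text \<open>
  A finite simple undirected graph is a digraph satisfying the locale \<^locale>\<open>graph\<close>: finite,
  loop-free, without parallel arcs, and symmetric. Each undirected edge is thus represented
  by two opposite arcs, so the degree of a vertex is its out-degree.
\<close>

definition pendant :: "('a, 'b) pre_digraph \<Rightarrow> 'a \<Rightarrow> bool" where
  "pendant G v \<longleftrightarrow> v \<in> verts G \<and> out_degree G v = 1"

text \<open>
  Colorings are extensional functions (undefined outside the vertex set), so that equality
  of functions is equality of colorings and colorings can be counted.
\<close>

definition proper_coloring :: "nat \<Rightarrow> ('a, 'b) pre_digraph \<Rightarrow> ('a \<Rightarrow> nat) \<Rightarrow> bool" where
  "proper_coloring k G c \<longleftrightarrow>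
     c \<in> verts G \<rightarrow>\<^sub>E {1..k} \<and> (\<forall>u v. u \<rightarrow>\<^bsub>G\<^esub> v \<longrightarrow> c u \<noteq> c v)"

definition chromatic_number :: "('a, 'b) pre_digraph \<Rightarrow> nat" where
  "chromatic_number G = (LEAST k. \<exists>c. proper_coloring k G c)"

definition extension ::
  "('a, 'b) pre_digraph \<Rightarrow> 'a set \<Rightarrow> ('a \<Rightarrow> nat) \<Rightarrow> ('a \<Rightarrow> nat) \<Rightarrow> bool" where
  "extension G S c\<^sub>0 c \<longleftrightarrow> proper_coloring (chromatic_number G) G c \<and> restrict c S = c\<^sub>0"

definition extendable :: "('a, 'b) pre_digraph \<Rightarrow> 'a set \<Rightarrow> ('a \<Rightarrow> nat) \<Rightarrow> bool" where
  "extendable G S c\<^sub>0 \<longleftrightarrow> (\<exists>c. extension G S c\<^sub>0 c)"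

definition sudoku_coloring :: "('a, 'b) pre_digraph \<Rightarrow> 'a set \<Rightarrow> ('a \<Rightarrow> nat) \<Rightarrow> bool" where
  "sudoku_coloring G S c\<^sub>0 \<longleftrightarrow> (\<exists>!c. extension G S c\<^sub>0 c)"

end

theory Submission
  imports Defs
begin

text \<open>A pendant vertex \<open>v\<close> has a single neighbour \<open>w\<close>, so a proper
  coloring \<open>c\<close> forbids only the color \<open>c w\<close> at \<open>v\<close>. As k
  \<ge> 3, some color \<open>d\<close> differs from both \<open>c v\<close> and \<open>c w\<close>.
  Recoloring \<open>v\<close> with \<open>d\<close> keeps the coloring proper and, since
  \<open>v\<close> lies outside \<open>S\<close>, does not change it on \<open>S\<close>. Every
  extension thus has a second one beside it. \<open>pendant_neighbour_unique\<close> supplies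
  \<open>w\<close>; \<open>proper_coloring_fun_upd\<close> justifies the recoloring.\<close>

lemma pendant_neighbour_unique:
  assumes "pendant G v"
  obtains w where "\<And>x. v \<rightarrow>\<^bsub>G\<^esub> x \<Longrightarrow> x = w"
proof -
  have "card (out_arcs G v) = 1"
    using assms by (simp add: pendant_def out_degree_def)
  then obtain e where e: "out_arcs G v = {e}"
    by (auto simp: card_1_singleton_iff)
  show thesis
  proof
    show "x = head G e" if "v \<rightarrow>\<^bsub>G\<^esub> x" for x
    proof -
      from that obtain a where "a \<in> out_arcs G v" "head G a = x"
        by (auto simp: arcs_ends_def arc_to_ends_def)
      then show ?thesis using e by auto
    qed
  qed
qed

text \<open>Only arcs at \<open>v\<close> are affected. The last assumption covers those leaving
  \<open>v\<close>, and symmetry carries it over to those entering \<open>v\<close>. Membership of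
  \<open>v\<close> in \<open>verts G\<close> keeps the updated function extensional.\<close>

lemma proper_coloring_fun_upd:
  assumes "sym_digraph G" and "proper_coloring k G c" and "v \<in> verts G"
    and "d \<in> {1..k}" and "\<And>x. v \<rightarrow>\<^bsub>G\<^esub> x \<Longrightarrow> c x \<noteq> d"
  shows "proper_coloring k G (c(v := d))"
proof -
  have adj: "c x \<noteq> c y" if "x \<rightarrow>\<^bsub>G\<^esub> y" for x y
    using assms(2) that by (auto simp: proper_coloring_def)
  have "sym (arcs_ends G)"
    using assms(1) by (simp add: sym_digraph_def sym_digraph_axioms_def symmetric_def)
  then have "c x \<noteq> d" if "x \<rightarrow>\<^bsub>G\<^esub> v" for x
    using assms(5)[of x] that by (auto dest: symD)
  \<comment> \<open>The case \<open>x = y = v\<close> cannot occur: by \<open>adj\<close>, a loop at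
    \<open>v\<close> would give \<open>c v \<noteq> c v\<close>.\<close>
  then have "\<forall>x y. x \<rightarrow>\<^bsub>G\<^esub> y \<longrightarrow> (c(v := d)) x \<noteq> (c(v := d)) y"
    using adj assms(5) by (metis fun_upd_apply)
  moreover have "c(v := d) \<in> verts G \<rightarrow>\<^sub>E {1..k}"
    using assms(2-4) by (auto simp: proper_coloring_def PiE_iff extensional_def)
  ultimately show ?thesis
    by (simp add: proper_coloring_def)
qed

theorem lemma2p6:
  fixes G :: "('a, 'b) pre_digraph" and k :: nat and S :: "'a set"
    and c\<^sub>0 :: "'a \<Rightarrow> nat" and v :: 'a
  assumes "graph G" and "connected G"
    and "chromatic_number G = k" and "k \<ge> 3"
    and "S \<subseteq> verts G"
    and "proper_coloring k (G \<restriction> S) c\<^sub>0"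
    and "extendable G S c\<^sub>0"
    and "pendant G v" and "v \<notin> S"
  shows "\<not> sudoku_coloring G S c\<^sub>0"
proof
  assume sudoku: "sudoku_coloring G S c\<^sub>0"
  obtain c where c: "extension G S c\<^sub>0 c"
    using assms(7) by (auto simp: extendable_def)
  obtain w where w: "\<And>x. v \<rightarrow>\<^bsub>G\<^esub> x \<Longrightarrow> x = w"
    using pendant_neighbour_unique[OF assms(8)] by blast
  \<comment> \<open>This is where k \<ge> 3 enters: at most two colors must be avoided,
    \<open>c w\<close> for properness and \<open>c v\<close> to obtain a different coloring.\<close>
  have "card {c v, c w} < card {1..k}"
    using assms(4) by (simp add: card_insert_if)
  then have "\<not> {1..k} \<subseteq> {c v, c w}"
    using card_mono[of "{c v, c w}" "{1..k}"] by auto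
  then obtain d where d: "d \<in> {1..k}" "d \<noteq> c v" "d \<noteq> c w"
    by blast
  have "sym_digraph G"
    using assms(1) by (simp add: graph_def pseudo_graph_def sym_digraph_def digraph_def)
  moreover have "v \<in> verts G"
    using assms(8) by (simp add: pendant_def)
  ultimately have "proper_coloring k G (c(v := d))"
    using c assms(3) d w by (intro proper_coloring_fun_upd) (auto simp: extension_def)
  moreover have "restrict (c(v := d)) S = restrict c S"
    using assms(9) by (auto simp: restrict_def)
  ultimately have "extension G S c\<^sub>0 (c(v := d))"
    using c assms(3) by (simp add: extension_def)
  with sudoku c have "c(v := d) = c"
    by (auto simp: sudoku_coloring_def)
  then show False
    using d(2) by (metis fun_upd_same)
qed

end
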